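(* Let $q$ be a power of a prime $p$, let $D\subseteq\mathbb{F}_q$ with $|D|=n$, $0\notin D$, and $D\cup\{0\}$ an additive subgroup of $\mathbb{F}_q$. Let $k,r\ge0$ be integers, $\gamma\in\mathbb{F}_q$, and write $T=q^{k-r}\binom{n}{r}\sum_{j=0}^{k-r}(-q)^{-j}\binom{n-r}{j}$. (a) If $\gamma\in D$, then $$N(x^{k+1}+\gamma x^k,r)=T+\frac{1}{n+1}(-1)^{k+1-r}\binom{n}{r}\binom{n-r}{k+1-r}-\frac{1}{n+1}(-1)^r\binom{k+1}{r}\sum_{0\le j\le (k+1)/p}(-1)^j\binom{(n+1)/p}{j}.$$ (b) If $\gamma\notin D\cup\{0\}$, then $N(x^{k+1}+\gamma x^k,r)=T$. (c) If $\gamma=0$, then $$N(x^{k+1}+\gamma x^k,r)=T+\frac{1}{n+1}(-1)^{k+1-r}\binom{n}{r}\binom{n-r}{k+1-r}+\frac{n}{n+1}(-1)^r\binom{k+1}{r}\sum_{0\le j\le (k+1)/p}(-1)^j\binom{(n+1)/p}{j}.$$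
   Context: $N(x^{k+1}+\gamma x^k,r)$ denotes the number of monic polynomials $g$ of degree $k+1$ over $\mathbb{F}_q$ whose coefficient of $x^k$ equals $\gamma$ and such that exactly $r$ elements $\alpha\in D$ satisfy $(x+\alpha)\mid g$. Binomial coefficients with out-of-range lower index are $0$ and empty sums are $0$. *)

theory Defs
  imports Complex_Main "HOL-Computational_Algebra.Polynomial" "HOL-Library.Cardinality"
begin

definition add_subgroup :: "'a::ab_group_add set \<Rightarrow> bool" where
  "add_subgroup H \<longleftrightarrow>
     0 \<in> H \<and> (\<forall>x\<in>H. \<forall>y\<in>H. x + y \<in> H) \<and> (\<forall>x\<in>H. - x \<in> H)"

(* N(x^(k+1) + \<gamma> x^k, r) with respect to D *)
definition N :: "'a::field set \<Rightarrow> nat \<Rightarrow> 'a \<Rightarrow> nat \<Rightarrow> nat" where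
  "N D k \<gamma> r =
     card {g :: 'a poly. degree g = k + 1 \<and> lead_coeff g = 1 \<and> coeff g k = \<gamma> \<and>
                         card {\<alpha> \<in> D. [:\<alpha>, 1:] dvd g} = r}"

(* Integer arguments: lower indices such as k + 1 - r and upper indices such as n - r may be
   negative, where truncated subtraction on nat would give wrong nonzero values. *)
definition binom :: "int \<Rightarrow> int \<Rightarrow> real" where
  "binom a b = (if 0 \<le> b \<and> b \<le> a then real (nat a choose nat b) else 0)"

definition T :: "nat \<Rightarrow> nat \<Rightarrow> nat \<Rightarrow> nat \<Rightarrow> real" where
  "T q n k r =
     real q powi (int k - int r) * binom (int n) (int r) *
     (\<Sum>j\<in>{0..int k - int r}. (- real q) powi (- j) * binom (int n - int r) j)"

end

theory Submission
  imports Defs "HOL-Number_Theory.Cong" "HOL-Library.Disjoint_Sets"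
begin

text \<open>
  Inclusion-exclusion over the sets \<open>S \<subseteq> D\<close> of prescribed factors \<open>x + \<alpha>\<close> reduces the count to the
  number of \<open>g\<close> divisible by all of them. For \<open>|S| \<le> k\<close> this is \<open>q ^ (k - |S|)\<close>, which gives \<open>T\<close>; for
  \<open>|S| = k + 1\<close> it is \<open>1\<close> or \<open>0\<close> according to whether \<open>\<Sum>S = \<gamma>\<close>. It remains to count the \<open>m\<close>-subsets of
  \<open>D\<close> with sum \<open>\<gamma>\<close>.

  No characters are needed for this. Fix \<open>c \<in> D\<close> and split the group \<open>H = D \<union> {0}\<close> into cosets of the
  subgroup of order \<open>p\<close> generated by \<open>c\<close>. If a subset of \<open>H\<close> meets some coset in neither \<open>0\<close> nor \<open>p\<close>
  elements, rotating it within that coset by multiples of \<open>c\<close> equidistributes its sum over a coset of the same subgroup. So only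
  unions of cosets contribute to the difference between the numbers of \<open>m\<close>-subsets with sum \<open>0\<close> and with
  sum \<open>c\<close>. Passing from \<open>H\<close> to \<open>D\<close> produces the alternating sum of binomial coefficients, and since all
  \<open>m\<close>-subset counts together add up to a binomial coefficient, the differences determine them.
\<close>

section \<open>Subset sums\<close>

definition subset_sum_count :: "'a::comm_monoid_add set \<Rightarrow> nat \<Rightarrow> 'a \<Rightarrow> nat" where
  "subset_sum_count A m \<gamma> = card {S. S \<subseteq> A \<and> card S = m \<and> \<Sum>S = \<gamma>}"

text \<open>The difference of counts at two targets that differ by \<open>c\<close>: every
  contribution invariant under shifting the target by \<open>c\<close> cancels. It is taken in
  \<open>int\<close> because it can be negative.\<close>

definition subset_sum_diff :: "'a::ab_group_add \<Rightarrow> 'a set \<Rightarrow> nat \<Rightarrow> 'a \<Rightarrow> int" where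
  "subset_sum_diff c A m \<gamma> = int (subset_sum_count A m \<gamma>) - int (subset_sum_count A m (\<gamma> + c))"

text \<open>The indicator form lets counts be recognised inside sums over \<open>Pow A\<close>, such
  as those produced by splitting a disjoint union.\<close>

lemma subset_sum_count_eq_sum:
  assumes "finite A"
  shows "int (subset_sum_count A m \<gamma>) = (\<Sum>S\<in>Pow A. of_bool (card S = m \<and> \<Sum>S = \<gamma>))"
proof -
  have "{S. S \<subseteq> A \<and> card S = m \<and> \<Sum>S = \<gamma>} = Pow A \<inter> {S. card S = m \<and> \<Sum>S = \<gamma>}"
    by auto
  then show ?thesis
    using assms by (simp add: subset_sum_count_def)
qed

text \<open>A subset of a disjoint union is determined by its traces on both parts, and sizes and
  sums add. The guard excludes large \<open>S\<close>, for which the truncated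
  \<open>m - card S\<close> would wrongly be 0.\<close>

lemma subset_sum_count_union:
  fixes A C :: "'a::ab_group_add set"
  assumes fin: "finite A" "finite C" and disj: "A \<inter> C = {}"
  shows "int (subset_sum_count (A \<union> C) m \<gamma>) =
    (\<Sum>S\<in>Pow A. if card S \<le> m then int (subset_sum_count C (m - card S) (\<gamma> - \<Sum>S)) else 0)"
proof -
  let ?I = "{S \<in> Pow A. card S \<le> m}"
  let ?F = "\<lambda>S. {T. T \<subseteq> C \<and> card T = m - card S \<and> \<Sum>T = \<gamma> - \<Sum>S}"
  have split: "card (S \<union> T) = card S + card T \<and> \<Sum>(S \<union> T) = \<Sum>S + \<Sum>T"
    if "S \<subseteq> A" "T \<subseteq> C" for S T
  proof -
    have "finite S" "finite T" "S \<inter> T = {}"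
      using that fin disj by (auto intro: finite_subset)
    then show ?thesis
      by (simp add: card_Un_disjoint sum.union_disjoint)
  qed
  have "bij_betw (\<lambda>(S, T). S \<union> T) (Sigma ?I ?F) {S. S \<subseteq> A \<union> C \<and> card S = m \<and> \<Sum>S = \<gamma>}"
  proof (rule bij_betw_byWitness[where f' = "\<lambda>U. (U \<inter> A, U \<inter> C)"])
    show "\<forall>x\<in>Sigma ?I ?F. (\<lambda>U. (U \<inter> A, U \<inter> C)) ((\<lambda>(S, T). S \<union> T) x) = x"
      using disj by auto
    show "\<forall>U\<in>{S. S \<subseteq> A \<union> C \<and> card S = m \<and> \<Sum>S = \<gamma>}. (\<lambda>(S, T). S \<union> T) (U \<inter> A, U \<inter> C) = U"
      by auto
    show "(\<lambda>(S, T). S \<union> T) ` Sigma ?I ?F \<subseteq> {S. S \<subseteq> A \<union> C \<and> card S = m \<and> \<Sum>S = \<gamma>}"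
      using split by auto
    show "(\<lambda>U. (U \<inter> A, U \<inter> C)) ` {S. S \<subseteq> A \<union> C \<and> card S = m \<and> \<Sum>S = \<gamma>} \<subseteq> Sigma ?I ?F"
    proof (rule image_subsetI)
      fix U assume U: "U \<in> {S. S \<subseteq> A \<union> C \<and> card S = m \<and> \<Sum>S = \<gamma>}"
      have "U = (U \<inter> A) \<union> (U \<inter> C)"
        using U by auto
      then have "card U = card (U \<inter> A) + card (U \<inter> C) \<and> \<Sum>U = \<Sum>(U \<inter> A) + \<Sum>(U \<inter> C)"
        using split[of "U \<inter> A" "U \<inter> C"] by (metis inf_le2)
      then have "card (U \<inter> C) = card U - card (U \<inter> A)" "\<Sum>(U \<inter> C) = \<Sum>U - \<Sum>(U \<inter> A)"
        "card (U \<inter> A) \<le> card U"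
        by (simp_all add: algebra_simps)
      then show "(U \<inter> A, U \<inter> C) \<in> Sigma ?I ?F"
        using U by auto
    qed
  qed
  then have "subset_sum_count (A \<union> C) m \<gamma> = card (Sigma ?I ?F)"
    by (simp add: subset_sum_count_def bij_betw_same_card)
  also have "\<dots> = (\<Sum>S\<in>?I. subset_sum_count C (m - card S) (\<gamma> - \<Sum>S))"
    using fin by (simp add: subset_sum_count_def)
  finally show ?thesis
    using fin by (simp add: sum.inter_filter[symmetric])
qed

text \<open>Membership of 0 changes the size of a subset but not its sum.\<close>

lemma subset_sum_count_insert_zero:
  assumes "finite (D :: 'a::ab_group_add set)" "0 \<notin> D"
  shows "subset_sum_count (insert 0 D) (Suc m) \<gamma> = subset_sum_count D (Suc m) \<gamma> + subset_sum_count D m \<gamma>"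
proof -
  have pow: "Pow {0::'a} = {{}, {0}}"
    by auto
  show "subset_sum_count (insert 0 D) (Suc m) \<gamma> = subset_sum_count D (Suc m) \<gamma> + subset_sum_count D m \<gamma>"
    using subset_sum_count_union[of "{0}" D "Suc m" \<gamma>] assms by (simp add: pow)
qed

lemma subset_sum_count_zero: "finite A \<Longrightarrow> subset_sum_count A 0 \<gamma> = of_bool (\<gamma> = 0)"
proof -
  assume "finite A"
  then have "{S. S \<subseteq> A \<and> card S = 0 \<and> \<Sum>S = \<gamma>} = (if \<gamma> = 0 then {{}} else {})"
    using finite_subset[of _ A] by auto
  then show ?thesis
    by (simp add: subset_sum_count_def)
qed

lemma subset_sum_count_card: "finite A \<Longrightarrow> subset_sum_count A (card A) \<gamma> = of_bool (\<gamma> = \<Sum>A)"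
proof -
  assume "finite A"
  then have "{S. S \<subseteq> A \<and> card S = card A \<and> \<Sum>S = \<gamma>} = (if \<gamma> = \<Sum>A then {A} else {})"
    using card_subset_eq[of A] by auto
  then show ?thesis
    by (simp add: subset_sum_count_def)
qed

lemma subset_sum_count_gt_card:
  assumes "finite A" "card A < m"
  shows "subset_sum_count A m \<gamma> = 0"
proof -
  have "{S. S \<subseteq> A \<and> card S = m \<and> \<Sum>S = \<gamma>} = {}"
    using assms card_mono[of A] by (auto simp: not_less[symmetric])
  then show ?thesis
    by (simp only: subset_sum_count_def card.empty)
qed

text \<open>Sums of elements of a subgroup stay in it; this settles case (b).\<close>

lemma subset_sum_count_not_in_subgroup:
  assumes "add_subgroup H" "D \<subseteq> H" "\<gamma> \<notin> H"
  shows "subset_sum_count D m \<gamma> = 0"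
proof -
  have "\<Sum>S \<in> H" if "S \<subseteq> D" for S
    using that assms(1,2) by (induction S rule: infinite_finite_induct) (auto simp: add_subgroup_def)
  then have "{S. S \<subseteq> D \<and> card S = m \<and> \<Sum>S = \<gamma>} = {}"
    using assms(3) by auto
  then show ?thesis
    by (simp only: subset_sum_count_def card.empty)
qed

text \<open>Classifying the \<open>m\<close>-subsets by their sum partitions them. This supplies the
  one equation that the differences of counts leave open.\<close>

lemma sum_subset_sum_count:
  assumes "finite D" "finite H" "\<And>S. S \<subseteq> D \<Longrightarrow> \<Sum>S \<in> H"
  shows "(\<Sum>\<gamma>\<in>H. subset_sum_count D m \<gamma>) = card D choose m"
proof -
  have "(\<Sum>\<gamma>\<in>H. subset_sum_count D m \<gamma>) = card (\<Union>\<gamma>\<in>H. {S. S \<subseteq> D \<and> card S = m \<and> \<Sum>S = \<gamma>})"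
    unfolding subset_sum_count_def using assms
    by (intro card_UN_disjoint[symmetric]) auto
  also have "(\<Union>\<gamma>\<in>H. {S. S \<subseteq> D \<and> card S = m \<and> \<Sum>S = \<gamma>}) = {S. S \<subseteq> D \<and> card S = m}"
    using assms(3) by auto
  finally show ?thesis
    using assms(1) by (simp add: n_subsets)
qed

section \<open>Cosets of a cyclic subgroup in characteristic p\<close>

text \<open>In characteristic \<open>p\<close> this is the additive subgroup generated by
  \<open>c\<close>. Indexing by all naturals makes closure under addition immediate.\<close>

definition multiples :: "'a::semiring_1 \<Rightarrow> 'a set" where
  "multiples c = range (\<lambda>i::nat. of_nat i * c)"

text \<open>Adding 1 permutes the field, so the sum of all elements is unchanged although it grows
  by the number of elements; hence \<open>p ^ e\<close> vanishes in the field, and so does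
  \<open>p\<close>.\<close>

lemma of_nat_char_eq_0:
  fixes p e :: nat
  assumes "CARD('a::{field,finite}) = p ^ e"
  shows "(of_nat p :: 'a) = 0"
proof -
  have "(\<Sum>x\<in>(UNIV::'a set). x) = (\<Sum>x\<in>UNIV. x + 1)"
    by (rule sum.reindex_bij_witness[of _ "\<lambda>x. x + 1" "\<lambda>x. x - 1"]) auto
  then have "(of_nat (p ^ e) :: 'a) = 0"
    by (simp add: sum.distrib assms)
  then show ?thesis
    by simp
qed

context
  fixes p :: nat and c :: "'a::{field,finite}"
  assumes p: "prime p" and char: "(of_nat p :: 'a) = 0" and c: "c \<noteq> 0"
begin

lemma of_nat_eq_of_nat_mod: "(of_nat i :: 'a) = of_nat (i mod p)"
proof -
  have "(of_nat i :: 'a) = of_nat (p * (i div p) + i mod p)"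
    by simp
  then show ?thesis
    by (simp only: of_nat_add of_nat_mult char) simp
qed

text \<open>Such an \<open>i\<close> has an inverse modulo \<open>p\<close>, which stays an inverse
  in the field.\<close>

lemma of_nat_neq_0:
  assumes "\<not> p dvd i"
  shows "(of_nat i :: 'a) \<noteq> 0"
proof
  assume 0: "(of_nat i :: 'a) = 0"
  have "coprime i p"
    using assms p by (metis coprime_commute prime_imp_coprime)
  then obtain x where "[i * x = Suc 0] (mod p)"
    using cong_solve_coprime_nat by blast
  then have "(of_nat (i * x) :: 'a) = of_nat (Suc 0)"
    by (metis of_nat_eq_of_nat_mod cong_def)
  with 0 show False
    by simp
qed

lemma multiples_eq: "multiples c = (\<lambda>i. of_nat i * c) ` {..<p}"
proof -
  have "of_nat i * c \<in> (\<lambda>i. of_nat i * c) ` {..<p}" for i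
    using p of_nat_eq_of_nat_mod[of i] by (intro image_eqI[of _ _ "i mod p"]) (simp_all add: prime_gt_0_nat)
  then show ?thesis
    by (auto simp: multiples_def)
qed

lemma inj_on_multiples: "inj_on (\<lambda>i. of_nat i * c) {..<p}"
proof (rule linorder_inj_onI')
  fix i j :: nat assume ij: "i \<in> {..<p}" "j \<in> {..<p}" "i < j"
  then have "\<not> p dvd (j - i)"
    using nat_dvd_not_less by force
  then have "(of_nat (j - i) :: 'a) \<noteq> 0"
    by (rule of_nat_neq_0)
  then show "of_nat i * c \<noteq> of_nat j * c"
    using c ij by (simp add: of_nat_diff)
qed

lemma card_multiples: "card (multiples c) = p"
  by (simp add: multiples_eq card_image inj_on_multiples)

lemma card_coset: "card ((+) a ` multiples c) = p"
  by (simp add: card_image card_multiples)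

text \<open>The \<open>p\<close> copies of \<open>a\<close> vanish, leaving \<open>c\<close> times
  p(p-1)/2. That factor is a multiple of \<open>p\<close> for odd \<open>p\<close> and equals 1 for
  \<open>p = 2\<close>.\<close>

lemma sum_coset: "\<Sum>((+) a ` multiples c) = (if p = 2 then c else 0)"
proof -
  have "\<Sum>((+) a ` multiples c) = (\<Sum>x\<in>multiples c. a + x)"
    by (simp add: sum.reindex)
  also have "\<dots> = \<Sum>(multiples c)"
    by (simp add: sum.distrib card_multiples char)
  also have "\<dots> = of_nat (\<Sum>{..<p}) * c"
    unfolding multiples_eq by (simp add: sum.reindex[OF inj_on_multiples] sum_distrib_right)
  also have "\<dots> = (if p = 2 then c else 0)"
  proof (cases "p = 2")
    case False
    then have "odd p"
      using p prime_odd_nat by (metis le_neq_implies_less prime_ge_2_nat)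
    then obtain u where u: "p = 2 * u + 1"
      by (auto elim: oddE)
    have "2 * \<Sum>{..<p} = p * (p - 1)"
      using gauss_sum_nat[of "p - 1"] u by (simp add: lessThan_Suc_atMost atLeast0AtMost)
    then have "\<Sum>{..<p} = p * u"
      using u by simp
    then show ?thesis
      using False char by simp
  qed (simp add: numeral_2_eq_2)
  finally show ?thesis .
qed

text \<open>Translating an \<open>i\<close>-subset of a coset by \<open>l * c\<close> with \<open>i * l \<equiv> 1\<close> modulo \<open>p\<close> adds \<open>c\<close> to its sum.\<close>

lemma subset_sum_diff_coset_middle:
  assumes i: "0 < i" "i < p"
  shows "subset_sum_diff c ((+) a ` multiples c) i \<beta> = 0"
proof -
  let ?C = "(+) a ` multiples c"
  have "\<not> p dvd i"
    using i by (simp add: nat_dvd_not_less)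
  then have "coprime i p"
    using p by (metis coprime_commute prime_imp_coprime)
  then obtain l where "[i * l = Suc 0] (mod p)"
    using cong_solve_coprime_nat by blast
  then have "(of_nat (i * l) :: 'a) = of_nat (Suc 0)"
    by (metis of_nat_eq_of_nat_mod cong_def)
  then have il: "(of_nat i * of_nat l :: 'a) = 1"
    by simp
  define d where "d = of_nat l * c"
  have id: "of_nat i * d = c"
    by (simp add: d_def il mult.assoc[symmetric])
  have "(\<lambda>x. d + x) ` ?C \<subseteq> ?C"
  proof clarify
    fix x assume "x \<in> multiples c"
    then obtain j where "x = of_nat j * c"
      by (auto simp: multiples_def)
    then have "d + (a + x) = a + of_nat (l + j) * c"
      by (simp add: d_def algebra_simps)
    then show "d + (a + x) \<in> ?C"
      unfolding multiples_def by blast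
  qed
  \<comment> \<open>Inclusion suffices, as translation is injective and the coset is finite.\<close>
  then have C: "(\<lambda>x. d + x) ` ?C = ?C"
    by (intro card_subset_eq) (simp_all add: card_image)
  have C': "(\<lambda>x. x - d) ` ?C = ?C"
    by (subst C[symmetric]) (simp add: image_image)
  have "bij_betw ((`) ((+) d)) {S. S \<subseteq> ?C \<and> card S = i \<and> \<Sum>S = \<beta>} {S. S \<subseteq> ?C \<and> card S = i \<and> \<Sum>S = \<beta> + c}"
  proof (rule bij_betw_byWitness[where f' = "(`) (\<lambda>x. x - d)"])
    show "\<forall>S\<in>{S. S \<subseteq> ?C \<and> card S = i \<and> \<Sum>S = \<beta>}. (\<lambda>x. x - d) ` (+) d ` S = S"
      by (simp add: image_image)
    show "\<forall>S\<in>{S. S \<subseteq> ?C \<and> card S = i \<and> \<Sum>S = \<beta> + c}. (+) d ` (\<lambda>x. x - d) ` S = S"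
      by (simp add: image_image)
    show "(`) ((+) d) ` {S. S \<subseteq> ?C \<and> card S = i \<and> \<Sum>S = \<beta>} \<subseteq> {S. S \<subseteq> ?C \<and> card S = i \<and> \<Sum>S = \<beta> + c}"
    proof clarify
      fix S assume "S \<subseteq> ?C" "i = card S"
      then have "(+) d ` S \<subseteq> ?C"
        using C by blast
      then show "(+) d ` S \<subseteq> ?C \<and> card ((+) d ` S) = card S \<and> \<Sum>((+) d ` S) = \<Sum>S + c"
        using id \<open>i = card S\<close> by (simp add: card_image sum.reindex sum.distrib)
    qed
    show "(`) (\<lambda>x. x - d) ` {S. S \<subseteq> ?C \<and> card S = i \<and> \<Sum>S = \<beta> + c} \<subseteq> {S. S \<subseteq> ?C \<and> card S = i \<and> \<Sum>S = \<beta>}"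
    proof clarify
      fix S assume S: "S \<subseteq> ?C" "i = card S" "\<Sum>S = \<beta> + c"
      then have "(\<lambda>x. x - d) ` S \<subseteq> ?C"
        using C' by blast
      moreover have "inj_on (\<lambda>x. x - d) S"
        by (simp add: inj_on_def)
      ultimately show "(\<lambda>x. x - d) ` S \<subseteq> ?C \<and> card ((\<lambda>x. x - d) ` S) = card S \<and> \<Sum>((\<lambda>x. x - d) ` S) = \<beta>"
        using id S by (simp add: card_image sum.reindex sum_subtractf)
    qed
  qed
  then show ?thesis
    by (simp add: subset_sum_diff_def subset_sum_count_def bij_betw_same_card)
qed

text \<open>Only the empty subset and the full coset fail to cancel. Their sums are 0 and the value
  from \<open>sum_coset\<close>; each gives one indicator per target.\<close>

lemma subset_sum_diff_coset:
  "subset_sum_diff c ((+) a ` multiples c) i \<beta> =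
    of_bool (i = 0 \<and> \<beta> = 0) - of_bool (i = 0 \<and> \<beta> + c = 0)
    + (of_bool (i = p \<and> \<beta> = (if p = 2 then c else 0)) - of_bool (i = p \<and> \<beta> + c = (if p = 2 then c else 0)))"
proof -
  have p0: "p > 0"
    using p by (rule prime_gt_0_nat)
  consider "i = 0" | "0 < i" "i < p" | "i = p" | "i > p"
    by linarith
  then show ?thesis
  proof cases
    case 1
    then show ?thesis
      using p0 by (simp add: subset_sum_diff_def subset_sum_count_zero)
  next
    case 2
    then show ?thesis
      by (simp add: subset_sum_diff_coset_middle)
  next
    case 3
    then show ?thesis
      using p0 subset_sum_count_card[of "(+) a ` multiples c"]
      by (simp only: subset_sum_diff_def card_coset sum_coset) simp
  next
    case 4
    then show ?thesis
      by (simp add: subset_sum_diff_def subset_sum_count_gt_card card_coset)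
  qed
qed

text \<open>After cancellation only the subsets that avoid the new coset or contain it entirely
  contribute. Containing it uses up \<open>p\<close> elements and shifts the target by the coset
  sum.\<close>

lemma subset_sum_diff_union_coset:
  assumes disj: "A \<inter> (+) a ` multiples c = {}"
  shows "subset_sum_diff c (A \<union> (+) a ` multiples c) m \<gamma> =
    subset_sum_diff c A m \<gamma> +
    (if p \<le> m then subset_sum_diff c A (m - p) (\<gamma> - (if p = 2 then c else 0)) else 0)"
proof -
  let ?C = "(+) a ` multiples c" and ?s = "if p = 2 then c else 0"
  have "subset_sum_diff c (A \<union> ?C) m \<gamma> =
      (\<Sum>S\<in>Pow A. if card S \<le> m then subset_sum_diff c ?C (m - card S) (\<gamma> - \<Sum>S) else 0)"
    unfolding subset_sum_diff_def subset_sum_count_union[OF finite finite disj] sum_subtractf[symmetric]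
    by (rule sum.cong) (auto simp: algebra_simps)
  also have "\<dots> = (\<Sum>S\<in>Pow A.
      of_bool (card S = m \<and> \<Sum>S = \<gamma>) - of_bool (card S = m \<and> \<Sum>S = \<gamma> + c) +
      (of_bool (p \<le> m \<and> card S = m - p \<and> \<Sum>S = \<gamma> - ?s) - of_bool (p \<le> m \<and> card S = m - p \<and> \<Sum>S = \<gamma> - ?s + c)))"
  proof (rule sum.cong[OF refl])
    fix S assume "S \<in> Pow A"
    have e: "(\<gamma> - \<Sum>S = 0) = (\<Sum>S = \<gamma>)" "(\<gamma> - \<Sum>S + c = 0) = (\<Sum>S = \<gamma> + c)"
      "(\<gamma> - \<Sum>S = ?s) = (\<Sum>S = \<gamma> - ?s)" "(\<gamma> - \<Sum>S + c = ?s) = (\<Sum>S = \<gamma> - ?s + c)"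
      by (auto simp: algebra_simps)
    show "(if card S \<le> m then subset_sum_diff c ?C (m - card S) (\<gamma> - \<Sum>S) else 0) =
      of_bool (card S = m \<and> \<Sum>S = \<gamma>) - of_bool (card S = m \<and> \<Sum>S = \<gamma> + c) +
      (of_bool (p \<le> m \<and> card S = m - p \<and> \<Sum>S = \<gamma> - ?s) - of_bool (p \<le> m \<and> card S = m - p \<and> \<Sum>S = \<gamma> - ?s + c))"
    proof (cases "card S \<le> m")
      case True
      then have "(m - card S = 0) = (card S = m)" "(m - card S = p) = (p \<le> m \<and> card S = m - p)"
        by auto
      then show ?thesis
        unfolding subset_sum_diff_coset e using True by simp
    qed auto
  qed
  also have "\<dots> = subset_sum_diff c A m \<gamma> +
    (if p \<le> m then subset_sum_diff c A (m - p) (\<gamma> - ?s) else 0)"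
    by (simp add: subset_sum_diff_def subset_sum_count_eq_sum sum.distrib sum_subtractf)
  finally show ?thesis .
qed

text \<open>For \<open>p = 2\<close> the shift by \<open>- c = c\<close> swaps the two targets and
  so negates the difference; for odd \<open>p\<close> there is no shift. The factor
  \<open>(-1) ^ (p + 1)\<close> covers both.\<close>

lemma subset_sum_diff_uminus_sum_coset:
  "subset_sum_diff c A m (0 - (if p = 2 then c else 0)) = (-1) ^ (p + 1) * subset_sum_diff c A m 0"
proof (cases "p = 2")
  case True
  then have "c + c = 0"
    using char by (metis mult_2 mult_zero_left of_nat_numeral)
  then have "- c = c"
    by (rule minus_unique)
  then have "subset_sum_count A m (- c) = subset_sum_count A m c"
    by (simp only:)
  then show ?thesis
    using True by (simp add: subset_sum_diff_def)
next
  case False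
  then have "odd p"
    using p prime_odd_nat by (metis le_neq_implies_less prime_ge_2_nat)
  then show ?thesis
    using False by simp
qed

text \<open>Only unions of \<open>m div p\<close> of the cosets survive, each coset carrying the
  sign \<open>(-1) ^ (p + 1)\<close>. Adding one coset is Pascal's rule.\<close>

lemma subset_sum_diff_Union_cosets:
  assumes "finite \<C>" "\<And>C. C \<in> \<C> \<Longrightarrow> \<exists>a. C = (+) a ` multiples c" "disjoint \<C>"
  shows "subset_sum_diff c (\<Union>\<C>) m 0 =
    (if p dvd m then (-1) ^ ((p + 1) * (m div p)) * int (card \<C> choose (m div p)) else 0)"
  using assms
proof (induction \<C> arbitrary: m rule: finite_induct)
  case empty
  have p0: "p > 0"
    using p by (rule prime_gt_0_nat)
  show ?case
  proof (cases "m = 0")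
    case True
    then show ?thesis
      using c by (simp add: subset_sum_diff_def subset_sum_count_zero)
  next
    case False
    then show ?thesis
      using p0 by (auto simp: subset_sum_diff_def subset_sum_count_gt_card elim!: dvdE)
  qed
next
  case (insert C \<C>)
  have p0: "p > 0"
    using p by (rule prime_gt_0_nat)
  obtain a where a: "C = (+) a ` multiples c"
    using insert.prems by blast
  have disj: "\<Union>\<C> \<inter> (+) a ` multiples c = {}"
    using insert.prems(2) insert.hyps(2) a by (fastforce simp: disjoint_def)
  have IH: "subset_sum_diff c (\<Union>\<C>) m 0 =
    (if p dvd m then (-1) ^ ((p + 1) * (m div p)) * int (card \<C> choose (m div p)) else 0)" for m
    using insert.IH insert.prems by (simp add: disjoint_def)
  have eq: "subset_sum_diff c (\<Union>(insert C \<C>)) m 0 = subset_sum_diff c (\<Union>\<C>) m 0 +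
    (if p \<le> m then (-1) ^ (p + 1) * subset_sum_diff c (\<Union>\<C>) (m - p) 0 else 0)"
    using subset_sum_diff_union_coset[OF disj, of m 0]
    by (simp only: subset_sum_diff_uminus_sum_coset Union_insert a Un_commute)
  show ?case
  proof (cases "p dvd m")
    case True
    then obtain j where j: "m = p * j"
      by blast
    show ?thesis
    proof (cases j)
      case 0
      then show ?thesis
        using eq IH[of m] j p0 by simp
    next
      case (Suc i)
      have m: "m div p = Suc i" "m - p = p * i" "p \<le> m" "p dvd m"
        using j Suc p0 by simp_all
      show ?thesis
        unfolding eq IH m using insert.hyps p0 m by (simp add: algebra_simps power_add)
    qed
  next
    case False
    then have "\<not> p dvd (m - p)" if "p \<le> m"
      using that by (simp add: dvd_minus_self)
    then show ?thesis
      using False eq IH by simp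
  qed
qed

section \<open>Coset decomposition of a subgroup, and removal of 0\<close>

lemma multiples_add: "x \<in> multiples c \<Longrightarrow> y \<in> multiples c \<Longrightarrow> x + y \<in> multiples c"
  by (auto simp: multiples_def distrib_right[symmetric] simp flip: of_nat_add)

lemma multiples_uminus: "x \<in> multiples c \<Longrightarrow> - x \<in> multiples c"
proof -
  assume "x \<in> multiples c"
  then obtain i where i: "i < p" "x = of_nat i * c"
    by (auto simp: multiples_eq)
  then have "- x = of_nat (p - i) * c"
    by (simp add: of_nat_diff char)
  then show ?thesis
    by (auto simp: multiples_def)
qed

lemma disjoint_cosets: "disjoint (range (\<lambda>a. (+) a ` multiples c))"
proof -
  have "(+) a ` multiples c \<subseteq> (+) b ` multiples c"
    if x: "x \<in> (+) a ` multiples c" "x \<in> (+) b ` multiples c" for a b x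
  proof clarify
    fix y assume y: "y \<in> multiples c"
    obtain u where u: "u \<in> multiples c" "x = a + u"
      using x(1) by blast
    obtain v where v: "v \<in> multiples c" "x = b + v"
      using x(2) by blast
    have "a = b + (v + - u)"
      using u(2) v(2) by (simp add: algebra_simps)
    then have "a + y = b + (v + - u + y)"
      by (simp add: add.assoc)
    moreover have "v + - u + y \<in> multiples c"
      using u v y by (intro multiples_add multiples_uminus)
    ultimately show "a + y \<in> (+) b ` multiples c"
      by blast
  qed
  then show ?thesis
    unfolding disjoint_def by blast
qed

text \<open>The cosets of \<open>multiples c\<close> partition \<open>H\<close> into
  \<open>card H div p\<close> blocks of size \<open>p\<close>.\<close>

lemma subset_sum_diff_subgroup:
  assumes H: "add_subgroup H" "c \<in> H"
  shows "subset_sum_diff c H m 0 =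
    (if p dvd m then (-1) ^ ((p + 1) * (m div p)) * int ((card H div p) choose (m div p)) else 0)"
proof -
  let ?\<C> = "(\<lambda>a. (+) a ` multiples c) ` H"
  have "of_nat i * c \<in> H" for i
    using H by (induction i) (auto simp: add_subgroup_def distrib_right)
  then have "a + x \<in> H" if "a \<in> H" "x \<in> multiples c" for a x
    using that H by (auto simp: add_subgroup_def multiples_def)
  moreover have "a \<in> (+) a ` multiples c" for a
    by (auto simp: multiples_def image_iff intro!: exI[of _ 0])
  ultimately have Un: "\<Union>?\<C> = H"
    by blast
  have disj: "disjoint ?\<C>"
    by (rule disjoint_cosets[THEN pairwise_subset]) auto
  have "card H = sum card ?\<C>"
    by (subst Un[symmetric], rule card_Union_disjoint) (use disj in auto)
  also have "\<dots> = (\<Sum>C\<in>?\<C>. p)"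
    by (rule sum.cong) (auto simp: card_coset)
  finally have "card ?\<C> = card H div p"
    using p by (simp add: prime_gt_0_nat)
  then show ?thesis
    using subset_sum_diff_Union_cosets[OF _ _ disj, of m] Un by fastforce
qed

text \<open>The difference for \<open>D\<close> at \<open>Suc m\<close> is the one for the subgroup
  at \<open>Suc m\<close> minus the one for \<open>D\<close> at \<open>m\<close>. Unrolled, this is
  an alternating sum of subgroup differences, which vanish off the multiples of
  \<open>p\<close>.\<close>

lemma subset_sum_diff_punctured_subgroup:
  assumes H: "add_subgroup (insert 0 D)" "c \<in> D" "0 \<notin> D"
  shows "subset_sum_diff c D m 0 =
    (-1) ^ m * (\<Sum>j = 0..m div p. (-1) ^ j * int ((card D + 1) div p choose j))"
proof -
  have fin: "finite D"
    by simp
  have card: "card (insert 0 D) = card D + 1"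
    using H by simp
  note H_eq = subset_sum_diff_subgroup[OF H(1), unfolded card]
  have p0: "p > 0"
    using p by (rule prime_gt_0_nat)
  show ?thesis
  proof (induction m)
    case 0
    then show ?case
      using c by (simp add: subset_sum_diff_def subset_sum_count_zero)
  next
    case (Suc m)
    have rec: "subset_sum_diff c D (Suc m) 0 = subset_sum_diff c (insert 0 D) (Suc m) 0 - subset_sum_diff c D m 0"
      unfolding subset_sum_diff_def subset_sum_count_insert_zero[OF fin H(3)] by simp
    show ?case
    proof (cases "p dvd Suc m")
      case True
      define J where "J = Suc m div p"
      have J: "Suc m = p * J"
        using True by (simp add: J_def)
      have Jm: "Suc (m div p) = J"
        using dvd_imp_mod_0[OF True] by (simp only: J_def div_Suc refl if_True)
      \<comment> \<open>With \<open>Suc m = p * J\<close> the sign splits into the global factor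
        \<open>(-1) ^ Suc m\<close> and the sign of the new summand \<open>j = J\<close>.\<close>
      have sgn: "(-1::int) ^ ((p + 1) * J) = (-1) ^ Suc m * (-1) ^ J"
      proof -
        have "(p + 1) * J = Suc m + J"
          using J by simp
        then show ?thesis
          by (simp only: power_add)
      qed
      have "subset_sum_diff c (insert 0 D) (Suc m) 0 = (-1) ^ Suc m * (-1) ^ J * int ((card D + 1) div p choose J)"
        using H_eq[of "Suc m"] H(2) True by (simp only: J_def[symmetric] sgn insertI2 if_True)
      then show ?thesis
        unfolding rec Suc J_def[symmetric] Jm[symmetric] by (simp add: algebra_simps)
    next
      case False
      \<comment> \<open>No summand is added here: the subgroup difference is 0 and only the global
        sign flips.\<close>
      then have "Suc m div p = m div p"
        by (simp only: div_Suc dvd_eq_mod_eq_0 if_False)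
      then show ?thesis
        using False H(2) H_eq rec Suc by simp
    qed
  qed
qed

end

text \<open>All counts at elements of \<open>D\<close> equal the count at 0 minus
  \<open>\<Delta> m\<close>, and the counts over the whole group add up to a binomial coefficient.
  This linear system is solved.\<close>

lemma subset_sum_count_punctured_subgroup:
  fixes D :: "'a::{field,finite} set"
  assumes p: "prime p" and char: "(of_nat p :: 'a) = 0"
    and H: "add_subgroup (insert 0 D)" "0 \<notin> D"
  defines "\<Delta> \<equiv> \<lambda>m. (-1) ^ m * (\<Sum>j = 0..m div p. (-1) ^ j * real ((card D + 1) div p choose j))"
  shows "\<gamma> \<in> D \<Longrightarrow> real (subset_sum_count D m \<gamma>) = (real (card D choose m) - \<Delta> m) / (real (card D) + 1)"
    and "real (subset_sum_count D m 0) = (real (card D choose m) + real (card D) * \<Delta> m) / (real (card D) + 1)"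
proof -
  have diff: "real (subset_sum_count D m \<gamma>) = real (subset_sum_count D m 0) - \<Delta> m" if "\<gamma> \<in> D" for \<gamma>
  proof -
    have "\<gamma> \<noteq> 0"
      using that H by auto
    \<comment> \<open>The generator \<open>c\<close> is \<open>\<gamma>\<close> itself, so the
      targets compared are 0 and \<open>\<gamma>\<close>.\<close>
    then have "real_of_int (subset_sum_diff \<gamma> D m 0) = \<Delta> m"
      using subset_sum_diff_punctured_subgroup[OF p char _ H(1) that H(2)] by (simp add: \<Delta>_def)
    then show ?thesis
      by (simp add: subset_sum_diff_def)
  qed
  have "\<Sum>S \<in> insert 0 D" if "S \<subseteq> D" for S
    using that H(1) by (induction S rule: infinite_finite_induct) (auto simp: add_subgroup_def)
  then have "(\<Sum>\<gamma>\<in>insert 0 D. real (subset_sum_count D m \<gamma>)) = real (card D choose m)"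
    by (subst sum_subset_sum_count[where H = "insert 0 D", symmetric]) simp_all
  then have total: "(real (card D) + 1) * real (subset_sum_count D m 0) - real (card D) * \<Delta> m = real (card D choose m)"
    using H(2) by (simp add: diff sum_subtractf algebra_simps)
  then show zero: "real (subset_sum_count D m 0) = (real (card D choose m) + real (card D) * \<Delta> m) / (real (card D) + 1)"
    by (simp add: field_simps)
  show "real (subset_sum_count D m \<gamma>) = (real (card D choose m) - \<Delta> m) / (real (card D) + 1)" if "\<gamma> \<in> D"
  proof -
    have "(real (card D) + 1) * real (subset_sum_count D m \<gamma>) = real (card D choose m) - \<Delta> m"
      using total unfolding diff[OF that] by (simp add: algebra_simps)
    then show ?thesis
      by (simp add: field_simps)
  qed
qed

section \<open>Monic polynomials with prescribed roots\<close>

definition monic_polys :: "nat \<Rightarrow> 'a::field \<Rightarrow> 'a poly set" where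
  "monic_polys k \<gamma> = {g. degree g = Suc k \<and> coeff g (Suc k) = 1 \<and> coeff g k = \<gamma>}"

lemma monic_polys_0: "monic_polys 0 \<gamma> = {[:\<gamma>, 1:]}"
proof
  show "monic_polys 0 \<gamma> \<subseteq> {[:\<gamma>, 1:]}"
  proof
    fix g assume g: "g \<in> monic_polys 0 \<gamma>"
    have "coeff g i = coeff [:\<gamma>, 1:] i" for i
    proof -
      consider "i = 0" | "i = Suc 0" | l where "i = Suc (Suc l)"
        by (metis not0_implies_Suc)
      then show ?thesis
        using g by cases (simp_all add: monic_polys_def coeff_eq_0)
    qed
    then show "g \<in> {[:\<gamma>, 1:]}"
      by (simp add: poly_eq_iff)
  qed
qed (simp add: monic_polys_def)

text \<open>The constant coefficient is free, so each further degree multiplies the count by the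
  size of the field.\<close>

lemma bij_betw_pCons_monic_polys:
  "bij_betw (\<lambda>(a, g). pCons a g) (UNIV \<times> monic_polys k \<gamma>) (monic_polys (Suc k) \<gamma>)"
proof -
  have mem: "pCons a g \<in> monic_polys (Suc k) \<gamma> \<longleftrightarrow> g \<in> monic_polys k \<gamma>" for a g
    by (cases "g = 0") (simp_all add: monic_polys_def)
  have "monic_polys (Suc k) \<gamma> \<subseteq> (\<lambda>(a, g). pCons a g) ` (UNIV \<times> monic_polys k \<gamma>)"
  proof
    fix g assume g: "g \<in> monic_polys (Suc k) \<gamma>"
    obtain a h where h: "g = pCons a h"
      by (rule pCons_cases)
    with g have "(a, h) \<in> UNIV \<times> monic_polys k \<gamma>"
      by (simp add: mem)
    then show "g \<in> (\<lambda>(a, g). pCons a g) ` (UNIV \<times> monic_polys k \<gamma>)"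
      using h by (intro image_eqI[of _ _ "(a, h)"]) simp_all
  qed
  then show ?thesis
    by (auto simp: bij_betw_def inj_on_def mem)
qed

lemma monic_polys_card:
  fixes \<gamma> :: "'a::{field,finite}"
  shows "finite (monic_polys k \<gamma>)" "card (monic_polys k \<gamma>) = CARD('a) ^ k"
proof -
  have "finite (monic_polys k \<gamma>) \<and> card (monic_polys k \<gamma>) = CARD('a) ^ k"
  proof (induction k)
    case (Suc k)
    then show ?case
      using bij_betw_finite[OF bij_betw_pCons_monic_polys[of k \<gamma>]]
        bij_betw_same_card[OF bij_betw_pCons_monic_polys[of k \<gamma>]]
      by (simp add: card_cartesian_product)
  qed (simp add: monic_polys_0)
  then show "finite (monic_polys k \<gamma>)" "card (monic_polys k \<gamma>) = CARD('a) ^ k"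
    by simp_all
qed

text \<open>The factor \<open>x + \<alpha>\<close> corresponds to the root
  \<open>- \<alpha>\<close>, and negation is injective.\<close>

lemma card_negated_roots_le:
  fixes g :: "'a::field poly"
  assumes "g \<noteq> 0"
  shows "card {\<alpha> \<in> D. [:\<alpha>, 1:] dvd g} \<le> degree g"
proof -
  have "[:\<alpha>, 1:] dvd g \<longleftrightarrow> poly g (- \<alpha>) = 0" for \<alpha>
    by (simp add: poly_eq_0_iff_dvd)
  then have "card {\<alpha> \<in> D. [:\<alpha>, 1:] dvd g} \<le> card {x. poly g x = 0}"
    using poly_roots_finite[OF assms] by (intro card_inj_on_le[of uminus]) auto
  then show ?thesis
    using card_poly_roots_bound[OF assms] by linarith
qed

text \<open>Dividing by \<open>x + a\<close> lowers the second coefficient by \<open>a\<close>, and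
  the factors indexed by \<open>S\<close>, being different from \<open>x + a\<close>, must divide
  the quotient.\<close>

lemma bij_betw_linear_factor_monic_polys:
  fixes a :: "'a::field"
  assumes "a \<notin> S"
  shows "bij_betw (\<lambda>g. [:a, 1:] * g) {g \<in> monic_polys k (\<gamma> - a). \<forall>\<alpha>\<in>S. [:\<alpha>, 1:] dvd g}
    {g \<in> monic_polys (Suc k) \<gamma>. \<forall>\<alpha>\<in>insert a S. [:\<alpha>, 1:] dvd g}"
proof -
  have dvd: "[:\<alpha>, 1:] dvd [:a, 1:] * g \<longleftrightarrow> [:\<alpha>, 1:] dvd g" if "\<alpha> \<in> S" for \<alpha> g
  proof -
    have "\<alpha> \<noteq> a"
      using that assms by auto
    moreover have "[:\<alpha>, 1:] dvd h \<longleftrightarrow> poly h (- \<alpha>) = 0" for h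
      by (simp add: poly_eq_0_iff_dvd)
    ultimately show ?thesis
      by simp
  qed
  have mem: "[:a, 1:] * g \<in> monic_polys (Suc k) \<gamma> \<longleftrightarrow> g \<in> monic_polys k (\<gamma> - a)" for g
  proof (cases "g = 0")
    case False
    then have deg: "degree ([:a, 1:] * g) = Suc (degree g)"
      by (subst degree_mult_eq) auto
    show ?thesis
    proof (cases "degree g = Suc k")
      case True
      \<comment> \<open>In the product, this coefficient is multiplied by \<open>a\<close> and added
        to the leading coefficient of \<open>g\<close>.\<close>
      then have "coeff g (Suc (Suc k)) = 0"
        by (simp add: coeff_eq_0)
      then show ?thesis
        using True deg by (auto simp: monic_polys_def algebra_simps)
    qed (use deg in \<open>simp add: monic_polys_def\<close>)
  qed (simp add: monic_polys_def)
  show ?thesis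
  proof (rule bij_betwI')
    fix g assume g: "g \<in> {g \<in> monic_polys (Suc k) \<gamma>. \<forall>\<alpha>\<in>insert a S. [:\<alpha>, 1:] dvd g}"
    then obtain h where "g = [:a, 1:] * h"
      by (auto elim: dvdE)
    then show "\<exists>x\<in>{g \<in> monic_polys k (\<gamma> - a). \<forall>\<alpha>\<in>S. [:\<alpha>, 1:] dvd g}. g = [:a, 1:] * x"
      using g dvd mem by (intro bexI[of _ h]) blast+
  next
    fix g assume g: "g \<in> {g \<in> monic_polys k (\<gamma> - a). \<forall>\<alpha>\<in>S. [:\<alpha>, 1:] dvd g}"
    then show "[:a, 1:] * g \<in> {g \<in> monic_polys (Suc k) \<gamma>. \<forall>\<alpha>\<in>insert a S. [:\<alpha>, 1:] dvd g}"
      using dvd mem by (auto simp del: mult_pCons_left)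
  qed (simp only: mult_cancel_left pCons_eq_0_iff one_neq_zero simp_thms)
qed

text \<open>Dividing out the factors one by one ends at unrestricted monic polynomials whose second
  coefficient is still prescribed; their number does not depend on its value.\<close>

lemma card_monic_polys_with_roots:
  fixes \<gamma> :: "'a::{field,finite}"
  assumes "card S \<le> k"
  shows "card {g \<in> monic_polys k \<gamma>. \<forall>\<alpha>\<in>S. [:\<alpha>, 1:] dvd g} = CARD('a) ^ (k - card S)"
  using finite[of S] assms
proof (induction S arbitrary: k \<gamma> rule: finite_induct)
  case empty
  then show ?case
    by (simp add: monic_polys_card)
next
  case (insert a S)
  then obtain l where l: "k = Suc l" "card S \<le> l"
    by (cases k) auto
  show ?case
    using bij_betw_same_card[OF bij_betw_linear_factor_monic_polys[OF insert.hyps(2), of l \<gamma>]]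
      insert.IH[OF l(2)] insert.hyps by (simp add: l(1))
qed

text \<open>The only candidate is the product of the \<open>x + \<alpha>\<close>, whose second
  coefficient is the sum of \<open>S\<close>.\<close>

lemma card_monic_polys_with_all_roots:
  fixes \<gamma> :: "'a::{field,finite}"
  assumes "card S = Suc k"
  shows "card {g \<in> monic_polys k \<gamma>. \<forall>\<alpha>\<in>S. [:\<alpha>, 1:] dvd g} = of_bool (\<Sum>S = \<gamma>)"
  using finite[of S] assms
proof (induction S arbitrary: k \<gamma> rule: finite_induct)
  case (insert a S)
  show ?case
  proof (cases k)
    case 0
    then have "S = {}"
      using insert by simp
    have "[:a, 1:] dvd [:\<gamma>, 1:] \<longleftrightarrow> poly [:\<gamma>, 1:] (- a) = 0"
      by (simp only: poly_eq_0_iff_dvd minus_minus)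
    then have "{g \<in> monic_polys k \<gamma>. \<forall>\<alpha>\<in>insert a S. [:\<alpha>, 1:] dvd g} = (if a = \<gamma> then {[:\<gamma>, 1:]} else {})"
      using 0 \<open>S = {}\<close> by (auto simp: monic_polys_0)
    then show ?thesis
      using \<open>S = {}\<close> by simp
  next
    case (Suc l)
    then have "card S = Suc l"
      using insert by simp
    then show ?thesis
      using bij_betw_same_card[OF bij_betw_linear_factor_monic_polys[OF insert.hyps(2), of l \<gamma>]]
        insert.IH[of l "\<gamma> - a"] insert.hyps by (simp add: Suc eq_diff_eq add.commute)
  qed
qed simp

section \<open>Inclusion-exclusion\<close>

text \<open>Both sides count pairs of an \<open>i\<close>-set and an \<open>r\<close>-subset of it;
  for \<open>i > n\<close> both vanish.\<close>

lemma choose_mult_choose: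
  fixes n r i :: nat
  assumes "r \<le> i"
  shows "(i choose r) * (n choose i) = (n choose r) * (n - r choose (i - r))"
proof (cases "i \<le> n")
  case True
  then show ?thesis
    using choose_mult[OF assms True] by (simp add: mult.commute)
next
  case False
  then have "n choose i = 0" "n choose r = 0 \<or> n - r choose (i - r) = 0"
    using assms by auto
  then show ?thesis
    by (elim disjE) (simp_all only: mult_zero_left mult_zero_right)
qed

text \<open>Binomial inversion: with \<open>s choose r\<close> taken out, an alternating row sum of
  Pascal's triangle remains, which vanishes unless \<open>s = r\<close>.\<close>

lemma sum_alternating_choose_mult:
  fixes r s K :: nat
  assumes "s \<le> K"
  shows "(\<Sum>i = r..K. (-1) ^ (i - r) * real (i choose r) * real (s choose i)) = of_bool (s = r)"
proof (cases "r \<le> s")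
  case False
  then have "(-1) ^ (i - r) * real (i choose r) * real (s choose i) = 0" if "i \<in> {r..K}" for i
    using that by simp
  then show ?thesis
    using False by (simp add: sum.neutral)
next
  case True
  have "(\<Sum>i = r..K. (-1) ^ (i - r) * real (i choose r) * real (s choose i))
      = (\<Sum>i = r..s. (-1) ^ (i - r) * real (i choose r) * real (s choose i))"
    using assms by (intro sum.mono_neutral_right) auto
  also have "\<dots> = (\<Sum>i = r..s. (-1) ^ (i - r) * real (s choose r) * real (s - r choose (i - r)))"
    by (rule sum.cong) (simp_all add: mult.assoc choose_mult_choose flip: of_nat_mult)
  also have "\<dots> = real (s choose r) * (\<Sum>i\<le>s - r. (-1) ^ i * real (s - r choose i))"
    unfolding sum_distrib_left
    by (rule sum.reindex_bij_witness[of _ "\<lambda>i. i + r" "\<lambda>i. i - r"]) (use True in auto)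
  also have "\<dots> = of_bool (s = r)"
    using True choose_alternating_sum[of "s - r", where 'a = real] by (cases "s = r") auto
  finally show ?thesis .
qed

text \<open>On level \<open>i\<close> each \<open>g\<close> is counted once for every
  \<open>i\<close>-subset of \<open>R g\<close>; binomial inversion for each \<open>g\<close> then
  isolates those with exactly \<open>r\<close> elements.\<close>

lemma card_exactly_eq_alternating_sum:
  fixes R :: "'g \<Rightarrow> 'a set"
  assumes fin: "finite G" "finite D" and R: "\<And>g. g \<in> G \<Longrightarrow> R g \<subseteq> D"
    and K: "\<And>g. g \<in> G \<Longrightarrow> card (R g) \<le> K"
  shows "real (card {g \<in> G. card (R g) = r}) =
    (\<Sum>i = r..K. (-1) ^ (i - r) * real (i choose r) * (\<Sum>S | S \<subseteq> D \<and> card S = i. real (card {g \<in> G. S \<subseteq> R g})))"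
proof -
  have count: "(\<Sum>S | S \<subseteq> D \<and> card S = i. real (card {g \<in> G. S \<subseteq> R g})) = (\<Sum>g\<in>G. real (card (R g) choose i))" for i
  proof -
    \<comment> \<open>Double counting of the pairs of \<open>S\<close> and \<open>g\<close> with
      \<open>S \<subseteq> R g\<close>.\<close>
    have "(\<Sum>S | S \<subseteq> D \<and> card S = i. card {g \<in> G. S \<subseteq> R g}) = (\<Sum>g\<in>G. card {S \<in> {S. S \<subseteq> D \<and> card S = i}. S \<subseteq> R g})"
      using fin by (intro sum_multicount_gen) auto
    also have "\<dots> = (\<Sum>g\<in>G. card (R g) choose i)"
    proof (rule sum.cong[OF refl])
      fix g assume g: "g \<in> G"
      then have "{S \<in> {S. S \<subseteq> D \<and> card S = i}. S \<subseteq> R g} = {S. S \<subseteq> R g \<and> card S = i}"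
        using R by auto
      then show "card {S \<in> {S. S \<subseteq> D \<and> card S = i}. S \<subseteq> R g} = card (R g) choose i"
        using R[OF g] fin by (simp add: n_subsets finite_subset)
    qed
    finally show ?thesis
      by (simp flip: of_nat_sum)
  qed
  have "real (card {g \<in> G. card (R g) = r}) = (\<Sum>g\<in>G. of_bool (card (R g) = r))"
    using fin by (simp add: Collect_conj_eq)
  also have "\<dots> = (\<Sum>g\<in>G. \<Sum>i = r..K. (-1) ^ (i - r) * real (i choose r) * real (card (R g) choose i))"
    by (rule sum.cong) (simp_all add: sum_alternating_choose_mult K)
  also have "\<dots> = (\<Sum>i = r..K. \<Sum>g\<in>G. (-1) ^ (i - r) * real (i choose r) * real (card (R g) choose i))"
    by (rule sum.swap)
  finally show ?thesis
    by (simp add: count sum_distrib_left)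
qed

section \<open>Alternating sums for \<open>T\<close> and \<open>N\<close>\<close>

lemma binom_of_nat: "binom (int a) (int b) = real (a choose b)"
  by (simp add: binom_def)

text \<open>For \<open>r > n\<close> the first factor is 0 on both sides, so the truncated
  \<open>n - r\<close> does no harm.\<close>

lemma binom_mult_binom_diff:
  "binom (int n) (int r) * binom (int n - int r) (int j) = real (n choose r) * real (n - r choose j)"
proof (cases "r \<le> n")
  case True
  then have "int n - int r = int (n - r)"
    by simp
  then show ?thesis
    by (simp only: binom_of_nat)
qed (simp add: binom_of_nat)

text \<open>The substitution \<open>i = r + j\<close> and \<open>choose_mult_choose\<close> turn
  \<open>T\<close> into the levels \<open>i \<le> k\<close> of the inclusion-exclusion sum.\<close>

lemma T_eq:
  assumes "q > 0"
  shows "T q n k r = (\<Sum>i = r..k. (-1) ^ (i - r) * real (i choose r) * (real (n choose i) * real q ^ (k - i)))"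
proof (cases "r \<le> k")
  case False
  then show ?thesis
    by (simp add: T_def)
next
  case True
  have powi: "real q powi (int k - int r) * (- real q) powi (- int (i - r)) = (-1) ^ (i - r) * real q ^ (k - i)"
    if "i \<in> {r..k}" for i
  proof -
    have "int k - int r = int ((k - i) + (i - r))"
      using that by auto
    then have "real q powi (int k - int r) = real q ^ (k - i) * real q ^ (i - r)"
      by (simp only: power_int_of_nat power_add)
    moreover have "(- real q) powi (- int (i - r)) = (-1) ^ (i - r) / real q ^ (i - r)"
    proof -
      have "(- real q) powi (- int (i - r)) = inverse ((- real q) ^ (i - r))"
        by (simp only: power_int_minus power_int_of_nat)
      also have "\<dots> = inverse ((-1) ^ (i - r)) * inverse (real q ^ (i - r))"
        by (simp only: power_minus[of "real q"] inverse_mult_distrib)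
      also have "inverse ((-1) ^ (i - r)) = (-1 :: real) ^ (i - r)"
        by (simp flip: power_inverse)
      finally show ?thesis
        by (simp only: divide_inverse)
    qed
    ultimately show ?thesis
      using assms by simp
  qed
  have "T q n k r = (\<Sum>j\<in>{0..int k - int r}. real q powi (int k - int r) * (- real q) powi (- j) *
      (binom (int n) (int r) * binom (int n - int r) j))"
    by (simp add: T_def sum_distrib_left mult_ac)
  also have "\<dots> = (\<Sum>i = r..k. real q powi (int k - int r) * (- real q) powi (- int (i - r)) *
      (binom (int n) (int r) * binom (int n - int r) (int (i - r))))"
    by (rule sum.reindex_bij_witness[of _ "\<lambda>i. int (i - r)" "\<lambda>j. nat j + r"]) (use True in auto)
  also have "\<dots> = (\<Sum>i = r..k. (-1) ^ (i - r) * real (i choose r) * (real (n choose i) * real q ^ (k - i)))"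
  proof (rule sum.cong[OF refl])
    fix i assume i: "i \<in> {r..k}"
    then have "real (i choose r) * real (n choose i) = real (n choose r) * real (n - r choose (i - r))"
      by (simp add: choose_mult_choose flip: of_nat_mult)
    then show "real q powi (int k - int r) * (- real q) powi (- int (i - r)) *
      (binom (int n) (int r) * binom (int n - int r) (int (i - r))) =
      (-1) ^ (i - r) * real (i choose r) * (real (n choose i) * real q ^ (k - i))"
      unfolding powi[OF i] binom_mult_binom_diff by (simp add: mult_ac)
  qed
  finally show ?thesis .
qed

text \<open>Only the top level \<open>i = k + 1\<close> depends on \<open>\<gamma>\<close>; the
  lower ones form \<open>T\<close>. If \<open>r > k + 1\<close>, the top level is absent and
  \<open>binom (int k + 1) (int r)\<close> is 0.\<close>

lemma N_eq:
  fixes D :: "'a::{field,finite} set"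
  shows "real (N D k \<gamma> r) = T CARD('a) (card D) k r +
    (-1) powi (int k + 1 - int r) * binom (int k + 1) (int r) * real (subset_sum_count D (k + 1) \<gamma>)"
proof -
  define f where "f = (\<lambda>i. (-1) ^ (i - r) * real (i choose r) *
      (\<Sum>S | S \<subseteq> D \<and> card S = i. real (card {g \<in> monic_polys k \<gamma>. \<forall>\<alpha>\<in>S. [:\<alpha>, 1:] dvd g})))"
  have "{g \<in> monic_polys k \<gamma>. S \<subseteq> {\<alpha> \<in> D. [:\<alpha>, 1:] dvd g}} = {g \<in> monic_polys k \<gamma>. \<forall>\<alpha>\<in>S. [:\<alpha>, 1:] dvd g}"
    if "S \<subseteq> D" for S
    using that by auto
  note subset = this
  have "N D k \<gamma> r = card {g \<in> monic_polys k \<gamma>. card {\<alpha> \<in> D. [:\<alpha>, 1:] dvd g} = r}"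
    unfolding N_def monic_polys_def by (rule arg_cong[where f = card]) auto
  then have "real (N D k \<gamma> r) = (\<Sum>i = r..Suc k. (-1) ^ (i - r) * real (i choose r) *
      (\<Sum>S | S \<subseteq> D \<and> card S = i. real (card {g \<in> monic_polys k \<gamma>. S \<subseteq> {\<alpha> \<in> D. [:\<alpha>, 1:] dvd g}})))"
  proof (simp only:, intro card_exactly_eq_alternating_sum)
    fix g assume "g \<in> monic_polys k \<gamma>"
    then have "g \<noteq> 0" "degree g = Suc k"
      by (auto simp: monic_polys_def)
    then show "card {\<alpha> \<in> D. [:\<alpha>, 1:] dvd g} \<le> Suc k"
      using card_negated_roots_le by metis
  qed (auto simp: monic_polys_card)
  also have "\<dots> = (\<Sum>i = r..Suc k. f i)"
    by (simp add: f_def subset)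
  also have "\<dots> = (\<Sum>i = r..k. f i) + (if r \<le> Suc k then f (Suc k) else 0)"
    by simp
  also have "(\<Sum>i = r..k. f i) = T CARD('a) (card D) k r"
    by (simp add: T_eq f_def card_monic_polys_with_roots n_subsets)
  also have "(if r \<le> Suc k then f (Suc k) else 0) =
    (-1) powi (int k + 1 - int r) * binom (int k + 1) (int r) * real (subset_sum_count D (k + 1) \<gamma>)"
  proof (cases "r \<le> Suc k")
    case True
    have "(\<Sum>S | S \<subseteq> D \<and> card S = Suc k. real (card {g \<in> monic_polys k \<gamma>. \<forall>\<alpha>\<in>S. [:\<alpha>, 1:] dvd g})) =
        (\<Sum>S | S \<subseteq> D \<and> card S = Suc k. of_bool (\<Sum>S = \<gamma>))"
      by (rule sum.cong) (simp_all add: card_monic_polys_with_all_roots)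
    also have "\<dots> = real (subset_sum_count D (Suc k) \<gamma>)"
      by (simp add: subset_sum_count_def Collect_conj_eq Int_assoc)
    finally have *: "f (Suc k) = (-1) ^ (Suc k - r) * real (Suc k choose r) * real (subset_sum_count D (Suc k) \<gamma>)"
      by (simp add: f_def)
    have "int k + 1 - int r = int (Suc k - r)" "int k + 1 = int (Suc k)"
      using True by auto
    then show ?thesis
      using True * by (simp only: power_int_of_nat binom_of_nat if_True Suc_eq_plus1)
  qed (simp add: binom_def)
  finally show ?thesis .
qed

section \<open>Assembly of the three cases\<close>

theorem theorem3:
  fixes D :: "'a::{field,finite} set" and \<gamma> :: 'a and p e q n k r :: nat
  assumes "prime p" and "q = p ^ e" and "CARD('a) = q"
    and "card D = n" and "0 \<notin> D" and "add_subgroup (D \<union> {0})"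
  shows "(\<gamma> \<in> D \<longrightarrow>
            real (N D k \<gamma> r) =
              T q n k r
              + 1 / (real n + 1) * (-1) powi (int k + 1 - int r)
                  * binom (int n) (int r) * binom (int n - int r) (int k + 1 - int r)
              - 1 / (real n + 1) * (-1) ^ r * binom (int k + 1) (int r)
                  * (\<Sum>j = 0..(k + 1) div p. (-1) ^ j * real (((n + 1) div p) choose j)))
       \<and> (\<gamma> \<notin> D \<union> {0} \<longrightarrow> real (N D k \<gamma> r) = T q n k r)
       \<and> (\<gamma> = 0 \<longrightarrow>
            real (N D k \<gamma> r) =
              T q n k r
              + 1 / (real n + 1) * (-1) powi (int k + 1 - int r)
                  * binom (int n) (int r) * binom (int n - int r) (int k + 1 - int r)
              + real n / (real n + 1) * (-1) ^ r * binom (int k + 1) (int r)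
                  * (\<Sum>j = 0..(k + 1) div p. (-1) ^ j * real (((n + 1) div p) choose j)))"
proof -
  have H: "add_subgroup (insert 0 D)"
    using assms(6) by simp
  have char: "(of_nat p :: 'a) = 0"
    using assms(2,3) by (intro of_nat_char_eq_0) simp
  define \<epsilon> :: real where "\<epsilon> = (-1) powi (int k + 1 - int r)"
  define \<Sigma> where "\<Sigma> = (\<Sum>j = 0..(k + 1) div p. (-1) ^ j * real (((n + 1) div p) choose j))"
  have N: "real (N D k \<gamma> r) = T q n k r + \<epsilon> * binom (int k + 1) (int r) * real (subset_sum_count D (k + 1) \<gamma>)"
    using N_eq[of D k \<gamma> r] assms(3,4) by (simp add: \<epsilon>_def)
  note count = subset_sum_count_punctured_subgroup[OF assms(1) char H assms(5), where m = "k + 1", unfolded assms(4), folded \<Sigma>_def]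
  \<comment> \<open>This is \<open>choose_mult_choose\<close> at \<open>i = k + 1\<close>. For
    \<open>r > k + 1\<close> both sides vanish, since \<open>int k + 1 - int r\<close> is negative
    and \<open>r\<close> exceeds \<open>k + 1\<close>.\<close>
  have choose: "\<epsilon> * binom (int n) (int r) * binom (int n - int r) (int k + 1 - int r) =
      \<epsilon> * binom (int k + 1) (int r) * real (n choose (k + 1))"
  proof (cases "r \<le> k + 1")
    case True
    have "binom (int n) (int r) * binom (int n - int r) (int k + 1 - int r) =
        real (n choose r) * real (n - r choose (k + 1 - r))"
    proof -
      have "int k + 1 - int r = int (k + 1 - r)"
        using True by simp
      then show ?thesis
        by (simp only: binom_mult_binom_diff)
    qed
    also have "\<dots> = real (k + 1 choose r) * real (n choose (k + 1))"
      using choose_mult_choose[OF True, of n] by (simp only: of_nat_mult[symmetric])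
    also have "real (k + 1 choose r) = binom (int k + 1) (int r)"
      using binom_of_nat[of "k + 1" r] by (simp only: of_nat_add of_nat_1)
    finally show ?thesis
      by simp
  next
    case False
    then show ?thesis
      by (simp add: binom_def)
  qed
  \<comment> \<open>The exponents \<open>k + 1 - r\<close> and \<open>k + 1\<close> add up to
    \<open>2 * (k + 1) - r\<close>, which has the parity of \<open>r\<close>.\<close>
  have sign: "\<epsilon> * binom (int k + 1) (int r) * (-1) ^ (k + 1) = (-1) ^ r * binom (int k + 1) (int r)"
  proof (cases "r \<le> k + 1")
    case True
    then have "int k + 1 - int r = int (k + 1 - r)"
      by simp
    then have "\<epsilon> = (-1) ^ (k + 1 - r)"
      unfolding \<epsilon>_def by (simp only: power_int_of_nat)
    moreover have "(-1::real) ^ (k + 1 - r) * (-1) ^ (k + 1) = (-1) ^ r"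
      using True by (auto simp: power_add[symmetric] minus_one_power_iff)
    ultimately show ?thesis
      by (metis mult.assoc mult.commute)
  next
    case False
    then show ?thesis
      by (simp add: binom_def)
  qed
  have case_D: "real (N D k \<gamma> r) = T q n k r
      + 1 / (real n + 1) * \<epsilon> * binom (int n) (int r) * binom (int n - int r) (int k + 1 - int r)
      - 1 / (real n + 1) * (-1) ^ r * binom (int k + 1) (int r) * \<Sigma>" if "\<gamma> \<in> D"
  proof -
    have "\<epsilon> * binom (int k + 1) (int r) * real (subset_sum_count D (k + 1) \<gamma>) =
        (\<epsilon> * binom (int k + 1) (int r) * real (n choose (k + 1))
          - \<epsilon> * binom (int k + 1) (int r) * (-1) ^ (k + 1) * \<Sigma>) / (real n + 1)"
      unfolding count(1)[OF that] by (simp add: algebra_simps diff_divide_distrib)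
    then show ?thesis
      unfolding N sign choose[symmetric] by (simp add: diff_divide_distrib)
  qed
  have case_0: "real (N D k \<gamma> r) = T q n k r
      + 1 / (real n + 1) * \<epsilon> * binom (int n) (int r) * binom (int n - int r) (int k + 1 - int r)
      + real n / (real n + 1) * (-1) ^ r * binom (int k + 1) (int r) * \<Sigma>" if "\<gamma> = 0"
  proof -
    have "\<epsilon> * binom (int k + 1) (int r) * real (subset_sum_count D (k + 1) \<gamma>) =
        (\<epsilon> * binom (int k + 1) (int r) * real (n choose (k + 1))
          + real n * (\<epsilon> * binom (int k + 1) (int r) * (-1) ^ (k + 1) * \<Sigma>)) / (real n + 1)"
      unfolding that count(2) by (simp add: algebra_simps add_divide_distrib)
    then show ?thesis
      unfolding N sign choose[symmetric] by (simp add: add_divide_distrib mult_ac)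
  qed
  have "real (N D k \<gamma> r) = T q n k r" if "\<gamma> \<notin> D \<union> {0}"
  proof -
    have "subset_sum_count D (k + 1) \<gamma> = 0"
      using that by (intro subset_sum_count_not_in_subgroup[OF H]) auto
    then show ?thesis
      using N by simp
  qed
  then show ?thesis
    using case_D case_0 unfolding \<epsilon>_def \<Sigma>_def by blast
qed

end
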